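(* Let $\alpha>0$ and $\nu>0$ be constants, let $L>0$ and $\delta>0$, and let $\mathcal{D}=(0,L)\times(0,\delta)\subset\mathbb{R}^2$ with coordinates $(x,y)$. Let $U,V\in C^\infty(\mathcal{D})$ satisfy the incompressibility condition $\partial_x U+\partial_y V=0$, let $p=p(x)$ be the pressure, with $p_x=\partial_x p$, and suppose that near $y=0$ the velocity components are given by power series in $y$ (treated as formal power series) $$U(x,y)=\sum_{k=1}^\infty a_k(x)\,y^k,\qquad V(x,y)=\sum_{k=1}^\infty b_k(x)\,y^k,$$ with $a_0=b_0=0$ (no-slip condition). Set $W=U-\alpha^2\,\partial_{yy}U$. Assume that $U,V$ satisfy the momentum equation of the Leray-$\alpha$ boundary layer model $$U\,\partial_x W+V\,\partial_y W=\nu\,\partial_{yy}W-p_x .$$ Then, for every integer $k\ge 4$, $$a_k=\frac{1}{\alpha^2\,k(k-1)}\left[a_{k-2}-\frac{C_{k-4}(x)+p_x\,\delta_{k-4,0}}{\nu\,(k-2)(k-3)}\right],$$ where $\delta_{k-4,0}$ is the Kronecker delta and, for every integer $m\ge 0$, $$C_m(x)=\sum_{i=1}^m a_i\,\dot w_{m-i}-\sum_{i=2}^m\frac{m-i+1}{i}\,\dot a_{i-1}\,w_{m-i+1},\qquad w_i=a_i-\alpha^2(i+2)(i+1)\,a_{i+2}.$$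
   Context: The variable $x$ is the streamwise coordinate along the wall $y=0$, and $y$ is the wall-normal coordinate. The constant $\alpha$ is the filter width and $\nu$ is the kinematic viscosity. A dot denotes the derivative with respect to $x$, empty sums are $0$, and $a_0=0$. All power series in $y$ are manipulated formally: they may be differentiated term by term in $x$ and $y$ and multiplied by the Cauchy product, and identities between them, including the momentum equation and the incompressibility condition, are understood coefficientwise in powers of $y$. In particular, incompressibility reads $b_k(x)=-\frac1k\,\partial_x a_{k-1}(x)$ for $k\ge1$. The $w_i$ are the coefficients of $W=\sum_{i\ge0}w_i(x)\,y^i$, and $C_m(x)$ is the coefficient of $y^m$ in the convective term $U\,\partial_xW+V\,\partial_yW$. *)

theory Defs
  imports
    "HOL-Analysis.Analysis"
    "HOL-Library.Landau_Symbols"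
    "HOL-Computational_Algebra.Formal_Power_Series"
begin

primrec Ck_on :: "nat \<Rightarrow> 'a::real_normed_vector set \<Rightarrow> ('a \<Rightarrow> 'b::real_normed_vector) \<Rightarrow> bool"
where
  "Ck_on 0 S f \<longleftrightarrow> continuous_on S f"
| "Ck_on (Suc n) S f \<longleftrightarrow>
     (\<forall>z\<in>S. f differentiable (at z)) \<and>
     (\<forall>v. Ck_on n S (\<lambda>z. frechet_derivative f (at z) v))"

text \<open>For open \<open>S\<close> in a finite-dimensional space this is membership in \<open>C\<^sup>\<infinity>(S)\<close>: every
  iterated directional derivative exists and is continuous on \<open>S\<close>.\<close>

definition Cinf_on :: "'a::real_normed_vector set \<Rightarrow> ('a \<Rightarrow> 'b::real_normed_vector) \<Rightarrow> bool" where
  "Cinf_on S f \<longleftrightarrow> (\<forall>n. Ck_on n S f)"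

text \<open>A formal power series in \<open>y\<close> whose coefficients are functions of \<open>x\<close> is represented by
  its coefficient family \<open>c\<close>, and at each fixed \<open>x\<close> it is a \<open>real fps\<close> in the variable \<open>y\<close>.\<close>

definition yseries :: "(nat \<Rightarrow> real \<Rightarrow> real) \<Rightarrow> real \<Rightarrow> real fps" where
  "yseries c x = Abs_fps (\<lambda>k. c k x)"

text \<open>The formal \<open>\<partial>\<^sub>x\<close> acts coefficientwise; the formal \<open>\<partial>\<^sub>y\<close> is \<^const>\<open>fps_deriv\<close>.\<close>

definition fps_dx :: "(real \<Rightarrow> real fps) \<Rightarrow> real \<Rightarrow> real fps" where
  "fps_dx F x = Abs_fps (\<lambda>k. deriv (\<lambda>t. fps_nth (F t) k) x)"

text \<open>The series is not required to converge: it represents \<open>F(x, \<cdot>)\<close> near the wall \<open>y = 0\<close>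
  as an asymptotic expansion for \<open>y\<close> tending to \<open>0\<close> from inside the domain. In particular every
  \<open>F\<close> that is the sum of the series for small \<open>y > 0\<close> is covered.\<close>

definition has_wall_series ::
  "(real \<times> real \<Rightarrow> real) \<Rightarrow> (nat \<Rightarrow> real \<Rightarrow> real) \<Rightarrow> real set \<Rightarrow> bool" where
  "has_wall_series F c X \<longleftrightarrow>
     (\<forall>x\<in>X. \<forall>n. (\<lambda>y. F (x, y) - (\<Sum>k\<le>n. c k x * y ^ k)) \<in> o[at_right 0](\<lambda>y. y ^ n))"

text \<open>\<open>W = U - \<alpha>\<^sup>2 \<partial>\<^sub>y\<^sub>y U\<close> for \<open>U = \<Sum>k. a k y\<^sup>k\<close>.\<close>

definition leray_W :: "real \<Rightarrow> (nat \<Rightarrow> real \<Rightarrow> real) \<Rightarrow> real \<Rightarrow> real fps" where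
  "leray_W \<alpha> a x =
     yseries a x - fps_const (\<alpha>\<^sup>2) * fps_deriv (fps_deriv (yseries a x))"

text \<open>\<open>U \<partial>\<^sub>x W + V \<partial>\<^sub>y W\<close> for \<open>U = \<Sum>k. a k y\<^sup>k\<close> and \<open>V = \<Sum>k. b k y\<^sup>k\<close>.\<close>

definition leray_convection ::
  "real \<Rightarrow> (nat \<Rightarrow> real \<Rightarrow> real) \<Rightarrow> (nat \<Rightarrow> real \<Rightarrow> real) \<Rightarrow> real \<Rightarrow> real fps" where
  "leray_convection \<alpha> a b x =
     yseries a x * fps_dx (leray_W \<alpha> a) x + yseries b x * fps_deriv (leray_W \<alpha> a x)"

definition w_coeff :: "real \<Rightarrow> (nat \<Rightarrow> real \<Rightarrow> real) \<Rightarrow> nat \<Rightarrow> real \<Rightarrow> real" where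
  "w_coeff \<alpha> a i x = fps_nth (leray_W \<alpha> a x) i"

definition C_coeff ::
  "real \<Rightarrow> (nat \<Rightarrow> real \<Rightarrow> real) \<Rightarrow> (nat \<Rightarrow> real \<Rightarrow> real) \<Rightarrow> nat \<Rightarrow> real \<Rightarrow> real" where
  "C_coeff \<alpha> a b m x = fps_nth (leray_convection \<alpha> a b x) m"

end

theory Submission
  imports Defs
begin

text \<open>The recursion is the momentum equation read off at the
  power \<open>y\<^sup>m\<close> with \<open>m = k - 4\<close>. The viscous term contributes \<open>\<nu> (m + 2) (m + 1) w\<^bsub>m+2\<^esub>\<close>, and
  since \<open>w\<^bsub>m+2\<^esub>\<close> contains \<open>a\<^bsub>m+4\<^esub>\<close> with the nonzero factor \<open>- \<alpha>\<^sup>2 (m + 4) (m + 3)\<close>, the equation can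
  be solved for \<open>a\<^bsub>m+4\<^esub> = a\<^bsub>k\<^esub>\<close> (lemma \<open>momentum_coeff_solve\<close>).

  The formula for \<open>C\<^sub>m\<close> comes from expanding the two Cauchy products and eliminating \<open>b\<^sub>i\<close> by
  incompressibility. The sums start later than the Cauchy products do because \<open>a\<^sub>0\<close> and \<open>b\<^sub>0\<close> vanish
  at the wall, and so does \<open>b\<^sub>1\<close>: as \<open>a\<^sub>0\<close> is zero along a whole open piece of the wall, its
  streamwise derivative, which is \<open>- b\<^sub>1\<close>, is zero as well (lemma \<open>C_coeff_wall\<close>).\<close>

lemma w_coeff_eq:
  "w_coeff \<alpha> a i x = a i x - \<alpha>\<^sup>2 * (real i + 2) * (real i + 1) * a (i + 2) x"
  by (simp add: w_coeff_def leray_W_def yseries_def algebra_simps)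

lemma incompressible_coeff:
  assumes "fps_dx (yseries a) x + fps_deriv (yseries b x) = 0"
  shows "b (Suc k) x = - deriv (a k) x / real (Suc k)"
proof -
  have "fps_nth (fps_dx (yseries a) x + fps_deriv (yseries b x)) k = 0"
    by (simp add: assms)
  then have "deriv (a k) x + real (Suc k) * b (Suc k) x = 0"
    by (simp add: fps_dx_def yseries_def)
  then show ?thesis
    by (simp add: field_simps del: of_nat_Suc)
qed

lemma C_coeff_cauchy:
  "C_coeff \<alpha> a b m x =
     (\<Sum>i=0..m. a i x * deriv (w_coeff \<alpha> a (m - i)) x) +
     (\<Sum>i=0..m. b i x * (real (m - i + 1) * w_coeff \<alpha> a (m - i + 1) x))"
proof -
  have "w_coeff \<alpha> a j = (\<lambda>t. fps_nth (leray_W \<alpha> a t) j)" for j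
    by (simp add: w_coeff_def fun_eq_iff)
  then show ?thesis
    by (simp add: C_coeff_def leray_convection_def fps_mult_nth fps_dx_def yseries_def)
qed

text \<open>The wall-normal velocity enters only through \<open>b\<^sub>i\<close> with \<open>i \<ge> 2\<close>: no slip removes \<open>b\<^sub>0\<close>, and
  incompressibility turns a vanishing streamwise derivative of \<open>a\<^sub>0\<close> into \<open>b\<^sub>1 = 0\<close>.\<close>

lemma C_coeff_wall:
  assumes a0: "a 0 x = 0" and da0: "deriv (a 0) x = 0" and b0: "b 0 x = 0"
    and inc: "fps_dx (yseries a) x + fps_deriv (yseries b x) = 0"
  shows "C_coeff \<alpha> a b m x =
       (\<Sum>i=1..m. a i x * deriv (w_coeff \<alpha> a (m - i)) x) -
       (\<Sum>i=2..m. real (m - i + 1) / real i * deriv (a (i - 1)) x *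
          w_coeff \<alpha> a (m - i + 1) x)"
proof -
  let ?g = "\<lambda>i. b i x * (real (m - i + 1) * w_coeff \<alpha> a (m - i + 1) x)"
  have b1: "b 1 x = 0"
    using incompressible_coeff[OF inc, of 0] da0 by simp
  have A: "(\<Sum>i=0..m. a i x * deriv (w_coeff \<alpha> a (m - i)) x) =
      (\<Sum>i=1..m. a i x * deriv (w_coeff \<alpha> a (m - i)) x)"
    by (simp add: sum.atLeast_Suc_atMost a0)
  have drop: "i = 0 \<or> i = 1" if "i \<in> {0..m} - {2..m}" for i
    using that by auto
  have "sum ?g {0..m} = sum ?g {2..m}"
    by (rule sum.mono_neutral_right) (use drop b0 b1 in force)+
  also have "\<dots> = (\<Sum>i=2..m. - (real (m - i + 1) / real i * deriv (a (i - 1)) x *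
          w_coeff \<alpha> a (m - i + 1) x))"
  proof (rule sum.cong[OF refl])
    fix i assume "i \<in> {2..m}"
    then have "b i x = - deriv (a (i - 1)) x / real i"
      using incompressible_coeff[OF inc, of "i - 1"] by simp
    then show "?g i = - (real (m - i + 1) / real i * deriv (a (i - 1)) x *
          w_coeff \<alpha> a (m - i + 1) x)"
      by simp
  qed
  finally show ?thesis
    unfolding C_coeff_cauchy A by (simp add: sum_negf)
qed

text \<open>The pressure gradient is constant in \<open>y\<close>, so it is felt at the power \<open>y\<^sup>0\<close> only.\<close>

lemma momentum_coeff:
  assumes "leray_convection \<alpha> a b x
        = fps_const \<nu> * fps_deriv (fps_deriv (leray_W \<alpha> a x)) - fps_const q"
  shows "C_coeff \<alpha> a b m x =
     \<nu> * (real m + 2) * (real m + 1) * w_coeff \<alpha> a (m + 2) x - q * (if m = 0 then 1 else 0)"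
  by (simp add: C_coeff_def w_coeff_def assms algebra_simps)

lemma momentum_coeff_solve:
  assumes "\<alpha> \<noteq> 0" and "\<nu> \<noteq> 0" and "k \<ge> 4"
    and mom: "leray_convection \<alpha> a b x
        = fps_const \<nu> * fps_deriv (fps_deriv (leray_W \<alpha> a x)) - fps_const q"
  shows "a k x = 1 / (\<alpha>\<^sup>2 * real k * (real k - 1)) *
       (a (k - 2) x -
        (C_coeff \<alpha> a b (k - 4) x + q * (if k - 4 = 0 then 1 else 0)) /
        (\<nu> * (real k - 2) * (real k - 3)))"
proof -
  obtain m where k: "k = m + 4"
    using \<open>k \<ge> 4\<close> by (metis add.commute le_Suc_ex)
  have r: "real k = real m + 4" "k - 4 = m" "k - 2 = m + 2"
    by (simp_all add: k)
  have visc: "(C_coeff \<alpha> a b m x + q * (if m = 0 then 1 else 0)) /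
      (\<nu> * (real k - 2) * (real k - 3)) = w_coeff \<alpha> a (m + 2) x"
    using \<open>\<nu> \<noteq> 0\<close> unfolding momentum_coeff[OF mom] r by (simp add: divide_simps) (simp add: algebra_simps)
  have "w_coeff \<alpha> a (m + 2) x = a (k - 2) x - \<alpha>\<^sup>2 * real k * (real k - 1) * a k x"
    unfolding w_coeff_eq r by (simp add: k numeral_eq_Suc)
  moreover have "\<alpha>\<^sup>2 * real k * (real k - 1) \<noteq> 0"
    using assms by simp
  ultimately show ?thesis
    unfolding r(2) visc by simp
qed

theorem theorem1:
  fixes \<alpha> \<nu> L \<delta> :: real
    and U V :: "real \<times> real \<Rightarrow> real"
    and p :: "real \<Rightarrow> real"
    and a b :: "nat \<Rightarrow> real \<Rightarrow> real"
  assumes "\<alpha> > 0" and "\<nu> > 0" and "L > 0" and "\<delta> > 0"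
    and "Cinf_on ({0<..<L} \<times> {0<..<\<delta>}) U"
    and "Cinf_on ({0<..<L} \<times> {0<..<\<delta>}) V"
    and "p differentiable_on {0<..<L}"
    and "has_wall_series U a {0<..<L}"
    and "has_wall_series V b {0<..<L}"
    and "\<And>k. a k differentiable_on {0<..<L}"
    and no_slip: "\<And>x. x \<in> {0<..<L} \<Longrightarrow> a 0 x = 0 \<and> b 0 x = 0"
    and incompressible: "\<And>x. x \<in> {0<..<L} \<Longrightarrow>
      fps_dx (yseries a) x + fps_deriv (yseries b x) = 0"
    and momentum: "\<And>x. x \<in> {0<..<L} \<Longrightarrow>
      yseries a x * fps_dx (leray_W \<alpha> a) x + yseries b x * fps_deriv (leray_W \<alpha> a x)
        = fps_const \<nu> * fps_deriv (fps_deriv (leray_W \<alpha> a x)) - fps_const (deriv p x)"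
  shows "\<forall>x\<in>{0<..<L}.
    (\<forall>k\<ge>4. a k x = 1 / (\<alpha>\<^sup>2 * real k * (real k - 1)) *
       (a (k - 2) x -
        (C_coeff \<alpha> a b (k - 4) x + deriv p x * (if k - 4 = 0 then 1 else 0)) /
        (\<nu> * (real k - 2) * (real k - 3)))) \<and>
    (\<forall>m. C_coeff \<alpha> a b m x =
       (\<Sum>i=1..m. a i x * deriv (w_coeff \<alpha> a (m - i)) x) -
       (\<Sum>i=2..m. real (m - i + 1) / real i * deriv (a (i - 1)) x *
          w_coeff \<alpha> a (m - i + 1) x)) \<and>
    (\<forall>i. w_coeff \<alpha> a i x = a i x - \<alpha>\<^sup>2 * (real i + 2) * (real i + 1) * a (i + 2) x)"
proof (intro ballI conjI allI impI)
  fix x assume x: "x \<in> {0<..<L}"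
  have mom: "leray_convection \<alpha> a b x
      = fps_const \<nu> * fps_deriv (fps_deriv (leray_W \<alpha> a x)) - fps_const (deriv p x)"
    unfolding leray_convection_def by (rule momentum[OF x])
  \<comment> \<open>No slip holds on a neighbourhood of \<open>x\<close>, so it may be differentiated along the wall.\<close>
  have "deriv (a 0) x = deriv (\<lambda>_. 0) x"
  proof (rule deriv_cong_ev[OF _ refl])
    show "\<forall>\<^sub>F t in nhds x. a 0 t = 0"
      using eventually_nhds_in_open[OF open_greaterThanLessThan x] no_slip
      by (auto elim: eventually_mono)
  qed
  then have da0: "deriv (a 0) x = 0"
    by simp
  show "a k x = 1 / (\<alpha>\<^sup>2 * real k * (real k - 1)) *
       (a (k - 2) x -
        (C_coeff \<alpha> a b (k - 4) x + deriv p x * (if k - 4 = 0 then 1 else 0)) /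
        (\<nu> * (real k - 2) * (real k - 3)))" if "4 \<le> k" for k
    using \<open>\<alpha> > 0\<close> \<open>\<nu> > 0\<close> that mom by (intro momentum_coeff_solve) auto
  show "C_coeff \<alpha> a b m x =
       (\<Sum>i=1..m. a i x * deriv (w_coeff \<alpha> a (m - i)) x) -
       (\<Sum>i=2..m. real (m - i + 1) / real i * deriv (a (i - 1)) x *
          w_coeff \<alpha> a (m - i + 1) x)" for m
    using no_slip[OF x] da0 incompressible[OF x] by (intro C_coeff_wall) auto
  show "w_coeff \<alpha> a i x = a i x - \<alpha>\<^sup>2 * (real i + 2) * (real i + 1) * a (i + 2) x" for i
    by (rule w_coeff_eq)
qed

end
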